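(* Let $R$ be an associative ring with identity and $M$ a right $R$-module. The following conditions are equivalent: (1) $M$ is SIP. (2) For any direct summand $A$ of $M$ and any split monomorphism $f: A\to M$, $A\cap f(A)$ is a direct summand of $M$. (3) For any direct summand $A$ of $M$ and any split epimorphism $f: M\to M/A$, $A\cap \mathrm{Ker}(f)$ is a direct summand of $M$.
   Context: A module $M$ is SIP if the intersection of any two direct summands of $M$ is a direct summand of $M$. A split monomorphism is a monomorphism whose image is a direct summand of its codomain; a split epimorphism is an epimorphism whose kernel is a direct summand of its domain. *)

theory Defs
  imports "HOL-Algebra.Module" "HOL-Algebra.AbelCoset"
begin

text \<open>
  HOL-Algebra's locale \<open>module\<close> demands a commutative scalar ring.  For right modules over an
  arbitrary ring we reuse its record type (and with it the locale \<open>submodule\<close>, which is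
  insensitive to the side): \<open>a \<odot>\<^bsub>M\<^esub> x\<close> stands for the right action \<open>x \<cdot> a\<close>, so that
  \<open>x \<cdot> (a b) = (x \<cdot> a) \<cdot> b\<close> becomes \<open>smult_assoc\<close> below.
\<close>

locale right_module = R?: ring R + M?: abelian_group M
    for R :: "('r, 'j) ring_scheme" (structure) and M :: "('r, 'm, 'k) module_scheme" (structure) +
  assumes smult_closed [simp, intro]:
      "\<lbrakk>a \<in> carrier R; x \<in> carrier M\<rbrakk> \<Longrightarrow> a \<odot>\<^bsub>M\<^esub> x \<in> carrier M"
    and smult_l_distr:
      "\<lbrakk>a \<in> carrier R; b \<in> carrier R; x \<in> carrier M\<rbrakk> \<Longrightarrow>
        (a \<oplus>\<^bsub>R\<^esub> b) \<odot>\<^bsub>M\<^esub> x = (a \<odot>\<^bsub>M\<^esub> x) \<oplus>\<^bsub>M\<^esub> (b \<odot>\<^bsub>M\<^esub> x)"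
    and smult_r_distr:
      "\<lbrakk>a \<in> carrier R; x \<in> carrier M; y \<in> carrier M\<rbrakk> \<Longrightarrow>
        a \<odot>\<^bsub>M\<^esub> (x \<oplus>\<^bsub>M\<^esub> y) = (a \<odot>\<^bsub>M\<^esub> x) \<oplus>\<^bsub>M\<^esub> (a \<odot>\<^bsub>M\<^esub> y)"
    and smult_assoc:
      "\<lbrakk>a \<in> carrier R; b \<in> carrier R; x \<in> carrier M\<rbrakk> \<Longrightarrow>
        (a \<otimes>\<^bsub>R\<^esub> b) \<odot>\<^bsub>M\<^esub> x = b \<odot>\<^bsub>M\<^esub> (a \<odot>\<^bsub>M\<^esub> x)"
    and smult_one [simp]:
      "x \<in> carrier M \<Longrightarrow> \<one>\<^bsub>R\<^esub> \<odot>\<^bsub>M\<^esub> x = x"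

definition direct_summand ::
    "('r, 'k) ring_scheme \<Rightarrow> ('r, 'm, 'l) module_scheme \<Rightarrow> 'm set \<Rightarrow> bool"
  where "direct_summand R M A \<longleftrightarrow>
    submodule A R M \<and>
    (\<exists>B. submodule B R M \<and> A <+>\<^bsub>M\<^esub> B = carrier M \<and> A \<inter> B = {\<zero>\<^bsub>M\<^esub>})"

definition SIP :: "('r, 'k) ring_scheme \<Rightarrow> ('r, 'm, 'l) module_scheme \<Rightarrow> bool"
  where "SIP R M \<longleftrightarrow>
    (\<forall>A B. direct_summand R M A \<longrightarrow> direct_summand R M B \<longrightarrow> direct_summand R M (A \<inter> B))"

definition module_hom ::
    "('r, 'k) ring_scheme \<Rightarrow> ('r, 'm, 'l) module_scheme \<Rightarrow> ('r, 'n, 'p) module_scheme \<Rightarrow> ('m \<Rightarrow> 'n) set"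
  where "module_hom R M N =
    {f \<in> carrier M \<rightarrow> carrier N.
      (\<forall>x\<in>carrier M. \<forall>y\<in>carrier M. f (x \<oplus>\<^bsub>M\<^esub> y) = f x \<oplus>\<^bsub>N\<^esub> f y) \<and>
      (\<forall>a\<in>carrier R. \<forall>x\<in>carrier M. f (a \<odot>\<^bsub>M\<^esub> x) = a \<odot>\<^bsub>N\<^esub> f x)}"

definition split_mono ::
    "('r, 'k) ring_scheme \<Rightarrow> ('r, 'm, 'l) module_scheme \<Rightarrow> ('r, 'n, 'p) module_scheme \<Rightarrow> ('m \<Rightarrow> 'n) \<Rightarrow> bool"
  where "split_mono R M N f \<longleftrightarrow>
    f \<in> module_hom R M N \<and> inj_on f (carrier M) \<and> direct_summand R N (f ` carrier M)"

definition split_epi ::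
    "('r, 'k) ring_scheme \<Rightarrow> ('r, 'm, 'l) module_scheme \<Rightarrow> ('r, 'n, 'p) module_scheme \<Rightarrow> ('m \<Rightarrow> 'n) \<Rightarrow> bool"
  where "split_epi R M N f \<longleftrightarrow>
    f \<in> module_hom R M N \<and> f ` carrier M = carrier N \<and> direct_summand R M (a_kernel M N f)"

text \<open>
  The quotient module \<open>M/A\<close>, on the pattern of \<open>FactRing\<close>.  The multiplicative fields, present
  only because the module record extends the ring record, are irrelevant.
\<close>

definition quot_module :: "('r, 'm, 'l) module_scheme \<Rightarrow> 'm set \<Rightarrow> ('r, 'm set) module"
  where "quot_module M A =
    \<lparr>carrier = a_rcosets\<^bsub>M\<^esub> A, mult = undefined, one = undefined,
     zero = A, add = set_add M,
     smult = (\<lambda>a C. \<Union>x\<in>C. A +>\<^bsub>M\<^esub> (a \<odot>\<^bsub>M\<^esub> x))\<rparr>"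

lemma (in right_module) quot_module_smult:
  assumes A: "submodule A R M" and a: "a \<in> carrier R" and x: "x \<in> carrier M"
  shows "a \<odot>\<^bsub>quot_module M A\<^esub> (A +>\<^bsub>M\<^esub> x) = A +>\<^bsub>M\<^esub> (a \<odot>\<^bsub>M\<^esub> x)"
proof -
  interpret A: submodule A R M by fact
  have sub: "subgroup A (add_monoid M)" by unfold_locales
  have AM: "A \<subseteq> carrier M" using A.subset by simp
  have eq: "A +>\<^bsub>M\<^esub> (a \<odot>\<^bsub>M\<^esub> y) = A +>\<^bsub>M\<^esub> (a \<odot>\<^bsub>M\<^esub> x)" if y: "y \<in> A +>\<^bsub>M\<^esub> x" for y
  proof -
    obtain h where h: "h \<in> A" "y = h \<oplus>\<^bsub>M\<^esub> x" using y by (auto simp: a_r_coset_def')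
    have "a \<odot>\<^bsub>M\<^esub> y = (a \<odot>\<^bsub>M\<^esub> h) \<oplus>\<^bsub>M\<^esub> (a \<odot>\<^bsub>M\<^esub> x)"
      unfolding h(2) using AM h(1) by (intro smult_r_distr a x) blast
    then have "a \<odot>\<^bsub>M\<^esub> y \<in> A +>\<^bsub>M\<^esub> (a \<odot>\<^bsub>M\<^esub> x)"
      using A.smult_closed[OF a h(1)] unfolding a_r_coset_def' by blast
    then show ?thesis
      using M.a_repr_independence[OF _ smult_closed[OF a x] sub] by simp
  qed
  have "x \<in> A +>\<^bsub>M\<^esub> x"
    using M.add.rcos_self[OF x sub] by (simp add: a_r_coset_def)
  then have "(\<Union>y\<in>A +>\<^bsub>M\<^esub> x. A +>\<^bsub>M\<^esub> (a \<odot>\<^bsub>M\<^esub> y)) = A +>\<^bsub>M\<^esub> (a \<odot>\<^bsub>M\<^esub> x)"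
    using eq by blast
  then show ?thesis by (simp add: quot_module_def)
qed

lemma (in right_module) right_module_quot_module:
  assumes A: "submodule A R M"
  shows "right_module R (quot_module M A)"
proof -
  interpret A: submodule A R M by fact
  have sub: "additive_subgroup A M"
    by (intro additive_subgroup.intro) unfold_locales
  interpret S: abelian_subgroup A M
    by (rule abelian_subgroupI3[OF sub M.abelian_group_axioms])
  note smult = quot_module_smult[OF A]
  have car: "carrier (quot_module M A) = (\<lambda>x. A +>\<^bsub>M\<^esub> x) ` carrier M"
    by (auto simp: quot_module_def A_RCOSETS_def')
  have add: "(A +>\<^bsub>M\<^esub> x) \<oplus>\<^bsub>quot_module M A\<^esub> (A +>\<^bsub>M\<^esub> y) = A +>\<^bsub>M\<^esub> (x \<oplus>\<^bsub>M\<^esub> y)"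
    if "x \<in> carrier M" "y \<in> carrier M" for x y
    using S.a_rcos_sum[OF that] by (simp add: quot_module_def)
  have zero: "\<zero>\<^bsub>quot_module M A\<^esub> = A +>\<^bsub>M\<^esub> \<zero>\<^bsub>M\<^esub>"
    using M.a_coset_add_zero[OF S.a_subset] by (simp add: quot_module_def)
  have "abelian_group (quot_module M A)"
  proof (rule abelian_groupI)
    show "C \<oplus>\<^bsub>quot_module M A\<^esub> D \<in> carrier (quot_module M A)"
      if "C \<in> carrier (quot_module M A)" "D \<in> carrier (quot_module M A)" for C D
      using that unfolding car by (force simp: add)
    show "\<zero>\<^bsub>quot_module M A\<^esub> \<in> carrier (quot_module M A)"
      unfolding car zero by blast
    show "C \<oplus>\<^bsub>quot_module M A\<^esub> D \<oplus>\<^bsub>quot_module M A\<^esub> E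
        = C \<oplus>\<^bsub>quot_module M A\<^esub> (D \<oplus>\<^bsub>quot_module M A\<^esub> E)"
      if "C \<in> carrier (quot_module M A)" "D \<in> carrier (quot_module M A)"
        "E \<in> carrier (quot_module M A)" for C D E
      using that unfolding car by (elim imageE) (simp add: add M.a_assoc)
    show "C \<oplus>\<^bsub>quot_module M A\<^esub> D = D \<oplus>\<^bsub>quot_module M A\<^esub> C"
      if "C \<in> carrier (quot_module M A)" "D \<in> carrier (quot_module M A)" for C D
      using that unfolding car by (elim imageE) (simp add: add M.a_comm)
    show "\<zero>\<^bsub>quot_module M A\<^esub> \<oplus>\<^bsub>quot_module M A\<^esub> C = C"
      if "C \<in> carrier (quot_module M A)" for C
      using that unfolding car zero by (elim imageE) (simp add: add)
    show "\<exists>D\<in>carrier (quot_module M A). D \<oplus>\<^bsub>quot_module M A\<^esub> C = \<zero>\<^bsub>quot_module M A\<^esub>"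
      if "C \<in> carrier (quot_module M A)" for C
    proof -
      obtain x where x: "x \<in> carrier M" "C = A +>\<^bsub>M\<^esub> x" using \<open>C \<in> _\<close> unfolding car by blast
      then have "(A +>\<^bsub>M\<^esub> (\<ominus>\<^bsub>M\<^esub> x)) \<oplus>\<^bsub>quot_module M A\<^esub> C = \<zero>\<^bsub>quot_module M A\<^esub>"
        by (simp add: add zero M.l_neg)
      with x(1) show ?thesis unfolding car by blast
    qed
  qed
  moreover have "right_module_axioms R (quot_module M A)"
  proof (rule right_module_axioms.intro)
    fix a C assume "a \<in> carrier R" "C \<in> carrier (quot_module M A)"
    then show "a \<odot>\<^bsub>quot_module M A\<^esub> C \<in> carrier (quot_module M A)"
      unfolding car by (elim imageE) (simp add: smult)
  next
    fix a b C assume "a \<in> carrier R" "b \<in> carrier R" "C \<in> carrier (quot_module M A)"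
    then show "(a \<oplus>\<^bsub>R\<^esub> b) \<odot>\<^bsub>quot_module M A\<^esub> C
        = (a \<odot>\<^bsub>quot_module M A\<^esub> C) \<oplus>\<^bsub>quot_module M A\<^esub> (b \<odot>\<^bsub>quot_module M A\<^esub> C)"
      unfolding car by (elim imageE) (simp add: smult add smult_l_distr)
  next
    fix a C D assume "a \<in> carrier R" "C \<in> carrier (quot_module M A)" "D \<in> carrier (quot_module M A)"
    then show "a \<odot>\<^bsub>quot_module M A\<^esub> (C \<oplus>\<^bsub>quot_module M A\<^esub> D)
        = (a \<odot>\<^bsub>quot_module M A\<^esub> C) \<oplus>\<^bsub>quot_module M A\<^esub> (a \<odot>\<^bsub>quot_module M A\<^esub> D)"
      unfolding car by (elim imageE) (simp add: smult add smult_r_distr)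
  next
    fix a b C assume "a \<in> carrier R" "b \<in> carrier R" "C \<in> carrier (quot_module M A)"
    then show "(a \<otimes>\<^bsub>R\<^esub> b) \<odot>\<^bsub>quot_module M A\<^esub> C
        = b \<odot>\<^bsub>quot_module M A\<^esub> (a \<odot>\<^bsub>quot_module M A\<^esub> C)"
      unfolding car by (elim imageE) (simp add: smult smult_assoc)
  next
    fix C assume "C \<in> carrier (quot_module M A)"
    then show "\<one>\<^bsub>R\<^esub> \<odot>\<^bsub>quot_module M A\<^esub> C = C"
      unfolding car by (elim imageE) (simp add: smult)
  qed
  ultimately show ?thesis
    by (intro right_module.intro R.ring_axioms)
qed

end

theory Submission
  imports Defs
begin

text \<open>
  Direct summands are the images of idempotent endomorphisms.  If \<open>e\<close> and \<open>q\<close> are idempotent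
  with images \<open>A\<close> and \<open>B\<close>, then \<open>h = q + (1 - q) e q\<close> is idempotent, and its image
  \<open>K = {x. x - e (q x) \<in> B}\<close> is both the image of \<open>B\<close> under the split monomorphism \<open>h\<close> and the
  kernel of the split epimorphism \<open>x \<mapsto> B + (x - e (q x))\<close> onto \<open>M/B\<close>.  So either condition makes
  \<open>B \<inter> K = {b \<in> B. e b \<in> B}\<close> a direct summand, say the image of an idempotent \<open>k\<close>, and then
  \<open>A \<inter> B\<close> is the image of the idempotent \<open>e k\<close>.
\<close>

section \<open>Homomorphisms, submodules and cosets\<close>

lemma module_homD:
  assumes "f \<in> module_hom R M N"
  shows "x \<in> carrier M \<Longrightarrow> f x \<in> carrier N"
    and "\<lbrakk>x \<in> carrier M; y \<in> carrier M\<rbrakk> \<Longrightarrow> f (x \<oplus>\<^bsub>M\<^esub> y) = f x \<oplus>\<^bsub>N\<^esub> f y"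
    and "\<lbrakk>a \<in> carrier R; x \<in> carrier M\<rbrakk> \<Longrightarrow> f (a \<odot>\<^bsub>M\<^esub> x) = a \<odot>\<^bsub>N\<^esub> f x"
  using assms by (auto simp: module_hom_def)

lemma module_hom_comp:
  assumes "f \<in> module_hom R M N" "g \<in> module_hom R N P"
  shows "(\<lambda>x. g (f x)) \<in> module_hom R M P"
  using assms by (auto simp: module_hom_def Pi_iff)

context right_module
begin

lemma smult_zero_right: "a \<in> carrier R \<Longrightarrow> a \<odot>\<^bsub>M\<^esub> \<zero>\<^bsub>M\<^esub> = \<zero>\<^bsub>M\<^esub>"
  using smult_r_distr[of a "\<zero>\<^bsub>M\<^esub>" "\<zero>\<^bsub>M\<^esub>"] M.add.l_cancel_one' by force

lemma smult_minus_right: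
  assumes "a \<in> carrier R" "x \<in> carrier M"
  shows "a \<odot>\<^bsub>M\<^esub> (\<ominus>\<^bsub>M\<^esub> x) = \<ominus>\<^bsub>M\<^esub> (a \<odot>\<^bsub>M\<^esub> x)"
proof -
  have "a \<odot>\<^bsub>M\<^esub> (\<ominus>\<^bsub>M\<^esub> x) \<oplus>\<^bsub>M\<^esub> (a \<odot>\<^bsub>M\<^esub> x) = \<zero>\<^bsub>M\<^esub>"
    using smult_r_distr[of a "\<ominus>\<^bsub>M\<^esub> x" x] assms by (simp add: M.l_neg smult_zero_right)
  then show ?thesis using assms by (simp add: M.minus_equality)
qed

lemma submoduleI:
  assumes "H \<subseteq> carrier M" "\<zero>\<^bsub>M\<^esub> \<in> H"
    and "\<And>x y. \<lbrakk>x \<in> H; y \<in> H\<rbrakk> \<Longrightarrow> x \<oplus>\<^bsub>M\<^esub> y \<in> H"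
    and "\<And>x. x \<in> H \<Longrightarrow> \<ominus>\<^bsub>M\<^esub> x \<in> H"
    and "\<And>a x. \<lbrakk>a \<in> carrier R; x \<in> H\<rbrakk> \<Longrightarrow> a \<odot>\<^bsub>M\<^esub> x \<in> H"
  shows "submodule H R M"
proof -
  have "subgroup H (add_monoid M)"
    using assms by (intro M.add.subgroupI) (auto simp: a_inv_def)
  then show ?thesis
    using assms by (simp add: submodule_def submodule_axioms_def)
qed

lemma submoduleD:
  assumes "submodule H R M"
  shows "H \<subseteq> carrier M" "\<zero>\<^bsub>M\<^esub> \<in> H"
    and "\<lbrakk>x \<in> H; y \<in> H\<rbrakk> \<Longrightarrow> x \<oplus>\<^bsub>M\<^esub> y \<in> H"
    and "x \<in> H \<Longrightarrow> \<ominus>\<^bsub>M\<^esub> x \<in> H"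
    and "\<lbrakk>x \<in> H; y \<in> H\<rbrakk> \<Longrightarrow> x \<ominus>\<^bsub>M\<^esub> y \<in> H"
    and "\<lbrakk>a \<in> carrier R; x \<in> H\<rbrakk> \<Longrightarrow> a \<odot>\<^bsub>M\<^esub> x \<in> H"
proof -
  interpret submodule H R M by fact
  show 1: "H \<subseteq> carrier M" "\<zero>\<^bsub>M\<^esub> \<in> H" "\<lbrakk>x \<in> H; y \<in> H\<rbrakk> \<Longrightarrow> x \<oplus>\<^bsub>M\<^esub> y \<in> H" for x y
    using subset one_closed m_closed by auto
  show 2: "x \<in> H \<Longrightarrow> \<ominus>\<^bsub>M\<^esub> x \<in> H" for x using m_inv_closed[of x] by (simp add: a_inv_def)
  show "\<lbrakk>x \<in> H; y \<in> H\<rbrakk> \<Longrightarrow> x \<ominus>\<^bsub>M\<^esub> y \<in> H" using 1 2 by (simp add: a_minus_def)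
  show "\<lbrakk>a \<in> carrier R; x \<in> H\<rbrakk> \<Longrightarrow> a \<odot>\<^bsub>M\<^esub> x \<in> H" by (rule smult_closed)
qed

text \<open>Serves to compute with a map into the quotient: both its kernel and its surjectivity
  become membership questions in \<open>H\<close>.\<close>

lemma submodule_coset_eq_iff:
  assumes "submodule H R M" "x \<in> carrier M" "y \<in> carrier M"
  shows "H +>\<^bsub>M\<^esub> x = H +>\<^bsub>M\<^esub> y \<longleftrightarrow> x \<ominus>\<^bsub>M\<^esub> y \<in> H"
proof -
  have sub: "subgroup H (add_monoid M)" using assms(1) by (simp add: submodule_def)
  interpret S: abelian_subgroup H M
    by (rule abelian_subgroupI3[OF additive_subgroup.intro[OF sub] M.abelian_group_axioms])
  have "H +>\<^bsub>M\<^esub> x = H +>\<^bsub>M\<^esub> y \<longleftrightarrow> x \<in> H +>\<^bsub>M\<^esub> y"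
    using M.a_repr_independence[OF _ assms(3) sub] S.a_rcos_self[OF assms(2)] by auto
  also have "\<dots> \<longleftrightarrow> x \<ominus>\<^bsub>M\<^esub> y \<in> H"
    using S.a_rcos_module assms(2,3) by (simp add: a_minus_def)
  finally show ?thesis .
qed

text \<open>The canonical projection; the split epimorphism onto the quotient arises by composing it
  with an endomorphism.\<close>

lemma coset_hom:
  assumes H: "submodule H R M"
  shows "(\<lambda>x. H +>\<^bsub>M\<^esub> x) \<in> module_hom R M (quot_module M H)"
proof -
  have "additive_subgroup H M" using H by (simp add: submodule_def additive_subgroup.intro)
  then interpret S: abelian_subgroup H M
    by (rule abelian_subgroupI3[OF _ M.abelian_group_axioms])
  show ?thesis
    using quot_module_smult[OF H] S.a_rcos_sum
    by (auto simp: module_hom_def quot_module_def A_RCOSETS_def')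
qed

section \<open>Arithmetic of endomorphisms\<close>

lemma module_hom_zero_minus:
  assumes f: "f \<in> module_hom R M M"
  shows "f \<zero>\<^bsub>M\<^esub> = \<zero>\<^bsub>M\<^esub>" "x \<in> carrier M \<Longrightarrow> f (\<ominus>\<^bsub>M\<^esub> x) = \<ominus>\<^bsub>M\<^esub> f x"
    "\<lbrakk>x \<in> carrier M; y \<in> carrier M\<rbrakk> \<Longrightarrow> f (x \<ominus>\<^bsub>M\<^esub> y) = f x \<ominus>\<^bsub>M\<^esub> f y"
proof -
  note h = module_homD[OF f]
  show z: "f \<zero>\<^bsub>M\<^esub> = \<zero>\<^bsub>M\<^esub>"
    using h(1)[of "\<zero>\<^bsub>M\<^esub>"] h(2)[of "\<zero>\<^bsub>M\<^esub>" "\<zero>\<^bsub>M\<^esub>"] M.add.l_cancel_one' by force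
  show m: "f (\<ominus>\<^bsub>M\<^esub> x) = \<ominus>\<^bsub>M\<^esub> f x" if "x \<in> carrier M" for x
    using h(2)[of "\<ominus>\<^bsub>M\<^esub> x" x] that z
    by (intro M.minus_equality[symmetric]) (simp_all add: h(1) M.l_neg)
  show "\<lbrakk>x \<in> carrier M; y \<in> carrier M\<rbrakk> \<Longrightarrow> f (x \<ominus>\<^bsub>M\<^esub> y) = f x \<ominus>\<^bsub>M\<^esub> f y"
    by (simp add: a_minus_def h(2) m)
qed

lemma module_hom_id: "(\<lambda>x. x) \<in> module_hom R M M"
  by (simp add: module_hom_def)

lemma module_hom_add:
  assumes "f \<in> module_hom R M M" "g \<in> module_hom R M M"
  shows "(\<lambda>x. f x \<oplus>\<^bsub>M\<^esub> g x) \<in> module_hom R M M"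
  using assms by (auto simp: module_hom_def Pi_iff smult_r_distr M.a_ac)

lemma module_hom_diff:
  assumes "f \<in> module_hom R M M" "g \<in> module_hom R M M"
  shows "(\<lambda>x. f x \<ominus>\<^bsub>M\<^esub> g x) \<in> module_hom R M M"
  using assms
  by (auto simp: module_hom_def Pi_iff a_minus_def smult_r_distr smult_minus_right M.minus_add M.a_ac)

section \<open>Direct summands as images of idempotent endomorphisms\<close>

text \<open>The complement is the kernel of \<open>e\<close>: every \<open>x\<close> splits as
  \<open>e x\<close> plus \<open>x - e x\<close>, and \<open>e\<close> kills the second term because
  it fixes \<open>e x\<close>.\<close>

lemma direct_summandI:
  assumes e: "e \<in> module_hom R M M" and im: "e ` carrier M = A" and idem: "\<And>x. x \<in> A \<Longrightarrow> e x = x"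
  shows "direct_summand R M A"
proof -
  let ?B = "{x \<in> carrier M. e x = \<zero>\<^bsub>M\<^esub>}"
  note h = module_homD[OF e] module_hom_zero_minus[OF e]
  have AM: "A \<subseteq> carrier M" using im h(1) by blast
  have eA: "e x \<in> A" if "x \<in> carrier M" for x using im that by blast
  have "submodule A R M"
  proof (rule submoduleI)
    \<comment> \<open>Elements of \<open>A\<close> are fixed by \<open>e\<close>, so a sum, negative
      or multiple of them is its own image under \<open>e\<close> and hence lies in
      \<open>A\<close>.\<close>
    show "\<zero>\<^bsub>M\<^esub> \<in> A" using eA[of "\<zero>\<^bsub>M\<^esub>"] h(4) by simp
    show "x \<oplus>\<^bsub>M\<^esub> y \<in> A" if "x \<in> A" "y \<in> A" for x y
      using eA[of "x \<oplus>\<^bsub>M\<^esub> y"] that AM idem h(2)[of x y] by (simp add: subset_iff)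
    show "\<ominus>\<^bsub>M\<^esub> x \<in> A" if "x \<in> A" for x
      using eA[of "\<ominus>\<^bsub>M\<^esub> x"] that AM idem h(5)[of x] by (simp add: subset_iff)
    show "a \<odot>\<^bsub>M\<^esub> x \<in> A" if "a \<in> carrier R" "x \<in> A" for a x
      using eA[of "a \<odot>\<^bsub>M\<^esub> x"] that AM idem h(3)[of a x] by (simp add: subset_iff)
  qed (rule AM)
  moreover have "submodule ?B R M"
    by (rule submoduleI) (auto simp: h smult_zero_right)
  moreover have "A <+>\<^bsub>M\<^esub> ?B = carrier M"
  proof
    show "A <+>\<^bsub>M\<^esub> ?B \<subseteq> carrier M" using AM by (auto simp: set_add_def')
    show "carrier M \<subseteq> A <+>\<^bsub>M\<^esub> ?B"
    proof
      fix x assume x: "x \<in> carrier M"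
      have "x = e x \<oplus>\<^bsub>M\<^esub> (x \<ominus>\<^bsub>M\<^esub> e x)"
        using x h(1) by (simp add: a_minus_def M.a_lcomm M.r_neg)
      moreover have "x \<ominus>\<^bsub>M\<^esub> e x \<in> ?B"
        using x h(1) idem[OF eA[OF x]] h(6)[of x "e x"] by (simp add: a_minus_def M.r_neg)
      ultimately show "x \<in> A <+>\<^bsub>M\<^esub> ?B" using eA[OF x] unfolding set_add_def' by blast
    qed
  qed
  moreover have "A \<inter> ?B = {\<zero>\<^bsub>M\<^esub>}"
    using idem \<open>submodule A R M\<close> submoduleD(2) h(4) by auto
  ultimately show ?thesis unfolding direct_summand_def by blast
qed

text \<open>\<open>e\<close> is the projection onto \<open>A\<close> along a complement
  \<open>B\<close>. It is characterised by \<open>e x \<in> A\<close> and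
  \<open>x - e x \<in> B\<close>, and its linearity follows from uniqueness of such a
  decomposition.\<close>

lemma direct_summandE:
  assumes "direct_summand R M A"
  obtains e where "e \<in> module_hom R M M" "e ` carrier M = A" "\<And>x. x \<in> A \<Longrightarrow> e x = x"
proof -
  obtain B where A: "submodule A R M" and B: "submodule B R M"
    and sum: "A <+>\<^bsub>M\<^esub> B = carrier M" and int: "A \<inter> B = {\<zero>\<^bsub>M\<^esub>}"
    using assms by (auto simp: direct_summand_def)
  note A' = submoduleD[OF A] and B' = submoduleD[OF B]
  have "\<exists>a. a \<in> A \<and> x \<ominus>\<^bsub>M\<^esub> a \<in> B" if x: "x \<in> carrier M" for x
  proof -
    obtain a b where "a \<in> A" "b \<in> B" "x = a \<oplus>\<^bsub>M\<^esub> b"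
      using x[folded sum] by (auto simp: set_add_def')
    moreover from this have "x \<ominus>\<^bsub>M\<^esub> a = b"
      using A'(1) B'(1) by (auto simp: subset_iff a_minus_def M.a_comm[of a b] M.a_assoc M.r_neg)
    ultimately show ?thesis by auto
  qed
  then obtain e where eA: "e x \<in> A" and eB: "x \<ominus>\<^bsub>M\<^esub> e x \<in> B" if "x \<in> carrier M" for x
    by metis
  have uniq: "e x = a" if x: "x \<in> carrier M" and a: "a \<in> A" and b: "x \<ominus>\<^bsub>M\<^esub> a \<in> B" for x a
  proof -
    have c: "a \<in> carrier M" "e x \<in> carrier M" using a eA[OF x] A'(1) by auto
    \<comment> \<open>The difference of two candidates for the \<open>A\<close>-component is also a
      difference of two \<open>B\<close>-components, so it lies in \<open>A \<inter> B\<close> and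
      vanishes.\<close>
    have "e x \<ominus>\<^bsub>M\<^esub> a = (x \<ominus>\<^bsub>M\<^esub> a) \<ominus>\<^bsub>M\<^esub> (x \<ominus>\<^bsub>M\<^esub> e x)"
      using c x M.r_neg2[of x "e x \<oplus>\<^bsub>M\<^esub> \<ominus>\<^bsub>M\<^esub> a"] by (simp add: a_minus_def M.minus_add M.a_ac)
    then have "e x \<ominus>\<^bsub>M\<^esub> a \<in> A \<inter> B" using A'(5)[OF eA[OF x] a] B'(5)[OF b eB[OF x]] by simp
    then have "e x \<oplus>\<^bsub>M\<^esub> \<ominus>\<^bsub>M\<^esub> a = \<zero>\<^bsub>M\<^esub>" using int by (simp add: a_minus_def)
    then show ?thesis using c M.minus_equality[of "e x" "\<ominus>\<^bsub>M\<^esub> a"] by simp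
  qed
  have em: "e x \<in> carrier M" if "x \<in> carrier M" for x using eA[OF that] A'(1) by blast
  have idem: "e x = x" if "x \<in> A" for x
    using uniq[of x x] that A'(1) B'(2) by (auto simp: subset_iff a_minus_def M.r_neg)
  show thesis
  proof
    show "e \<in> module_hom R M M"
    proof (unfold module_hom_def, safe)
      fix x y assume xy: "x \<in> carrier M" "y \<in> carrier M"
      \<comment> \<open>Exhibits \<open>e x + e y\<close> as an admissible
        \<open>A\<close>-component of \<open>x + y\<close>, so that \<open>uniq\<close> applies;
        scalar multiples are treated in the same way.\<close>
      have "(x \<oplus>\<^bsub>M\<^esub> y) \<ominus>\<^bsub>M\<^esub> (e x \<oplus>\<^bsub>M\<^esub> e y) = (x \<ominus>\<^bsub>M\<^esub> e x) \<oplus>\<^bsub>M\<^esub> (y \<ominus>\<^bsub>M\<^esub> e y)"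
        using xy em by (simp add: a_minus_def M.minus_add M.a_ac)
      then show "e (x \<oplus>\<^bsub>M\<^esub> y) = e x \<oplus>\<^bsub>M\<^esub> e y"
        using xy eA eB A'(3) B'(3) by (intro uniq) auto
    next
      fix a x assume ax: "a \<in> carrier R" "x \<in> carrier M"
      have "a \<odot>\<^bsub>M\<^esub> x \<ominus>\<^bsub>M\<^esub> a \<odot>\<^bsub>M\<^esub> e x = a \<odot>\<^bsub>M\<^esub> (x \<ominus>\<^bsub>M\<^esub> e x)"
        using ax em by (simp add: a_minus_def smult_r_distr smult_minus_right)
      then show "e (a \<odot>\<^bsub>M\<^esub> x) = a \<odot>\<^bsub>M\<^esub> e x"
        using ax eA eB A'(6) B'(6) by (intro uniq) auto
    qed (rule em)
    show "e ` carrier M = A" using eA idem A'(1) by force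
  qed (rule idem)
qed

lemma direct_summandD: "direct_summand R M A \<Longrightarrow> submodule A R M"
  by (simp add: direct_summand_def)

section \<open>Reduction of SIP to the intersection of \<open>B\<close> with one auxiliary summand
  \<open>K\<close>\<close>

text \<open>Carries out the construction shared by both converses, leaving open only the
  intersection \<open>B \<inter> K\<close>. Its premise describes \<open>K\<close> twice: as the
  image of \<open>h\<close>, suited to monomorphisms, and by a membership condition, suited to
  kernels.\<close>

lemma SIP_criterion:
  assumes "\<And>B e q h K.
      \<lbrakk>direct_summand R M B; direct_summand R M K;
       e \<in> module_hom R M M; q \<in> module_hom R M M; q ` carrier M = B; \<And>x. x \<in> B \<Longrightarrow> q x = x;
       h \<in> module_hom R M M; K = h ` carrier M; \<And>x. x \<in> carrier M \<Longrightarrow> h (q x) = h x;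
       \<And>x. x \<in> carrier M \<Longrightarrow> q (h x) = q x;
       K = {x \<in> carrier M. x \<ominus>\<^bsub>M\<^esub> e (q x) \<in> B}\<rbrakk>
      \<Longrightarrow> direct_summand R M (B \<inter> K)"
  shows "SIP R M"
  unfolding SIP_def
proof (intro allI impI)
  fix A B assume A: "direct_summand R M A" and B: "direct_summand R M B"
  obtain e where e: "e \<in> module_hom R M M" "e ` carrier M = A" "\<And>x. x \<in> A \<Longrightarrow> e x = x"
    using A by (rule direct_summandE) auto
  obtain q where q: "q \<in> module_hom R M M" "q ` carrier M = B" "\<And>x. x \<in> B \<Longrightarrow> q x = x"
    using B by (rule direct_summandE) auto
  note subB = submoduleD[OF direct_summandD[OF B]]
  note subA = submoduleD[OF direct_summandD[OF A]]
  note eh = module_homD[OF e(1)] module_hom_zero_minus[OF e(1)]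
  note qh = module_homD[OF q(1)] module_hom_zero_minus[OF q(1)]
  have qB: "q x \<in> B" if "x \<in> carrier M" for x using q(2) that by blast
  have eA: "e x \<in> A" if "x \<in> carrier M" for x using e(2) that by blast
  have qq: "q (q x) = q x" if "x \<in> carrier M" for x using q(3) qB that by blast
  \<comment> \<open>On \<open>B\<close> this is \<open>b \<mapsto> b + (1 - q) e b\<close>, so
    \<open>K\<close> is the graph of \<open>(1 - q) e\<close> as a map from \<open>B\<close> to the
    kernel of \<open>q\<close>. Then \<open>B \<inter> K\<close> is the kernel of that map.\<close>
  define h where "h x = q x \<oplus>\<^bsub>M\<^esub> (e (q x) \<ominus>\<^bsub>M\<^esub> q (e (q x)))" for x
  define K where "K = {x \<in> carrier M. x \<ominus>\<^bsub>M\<^esub> e (q x) \<in> B}"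
  have hom: "h \<in> module_hom R M M" unfolding h_def[abs_def]
    by (intro module_hom_add module_hom_diff module_hom_comp[OF q(1) e(1)] q(1)
        module_hom_comp[OF module_hom_comp[OF q(1) e(1)] q(1)])
  note hh = module_homD[OF hom]
  have qh_eq: "q (h x) = q x" if "x \<in> carrier M" for x
    using that by (simp add: h_def qh eh qq a_minus_def M.r_neg)
  have hq: "h (q x) = h x" if "x \<in> carrier M" for x
    using that by (simp add: h_def qq)
  have hK: "h x \<in> K" if x: "x \<in> carrier M" for x
  proof -
    \<comment> \<open>Once \<open>q (h x)\<close> is replaced by \<open>q x\<close>, the terms
      \<open>e (q x)\<close> cancel and a difference of two elements of \<open>B\<close>
      remains.\<close>
    have "h x \<ominus>\<^bsub>M\<^esub> e (q (h x)) = q x \<ominus>\<^bsub>M\<^esub> q (e (q x))"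
      unfolding qh_eq[OF x] using x
      by (simp add: h_def qh eh a_minus_def M.a_ac M.r_neg1 M.r_neg2 M.r_neg)
    then show ?thesis using x subB(5) qB eh qh hh unfolding K_def by auto
  qed
  have fixK: "h x = x" if x: "x \<in> K" for x
  proof -
    have xM: "x \<in> carrier M" using x by (simp add: K_def)
    \<comment> \<open>\<open>q\<close> fixes \<open>x - e (q x)\<close>, which lies in
      \<open>B\<close>; expanding the left side and adding \<open>e (q x)\<close> to both sides
      turns this into \<open>h x = x\<close>.\<close>
    have "q (x \<ominus>\<^bsub>M\<^esub> e (q x)) = x \<ominus>\<^bsub>M\<^esub> e (q x)" using x q(3) by (simp add: K_def)
    then have "q x \<ominus>\<^bsub>M\<^esub> q (e (q x)) = x \<ominus>\<^bsub>M\<^esub> e (q x)" using xM by (simp add: qh eh)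
    moreover have "h x = (q x \<ominus>\<^bsub>M\<^esub> q (e (q x))) \<oplus>\<^bsub>M\<^esub> e (q x)"
      using xM by (simp add: h_def qh eh a_minus_def M.a_ac)
    ultimately show ?thesis using xM by (simp add: qh eh a_minus_def M.a_assoc M.l_neg)
  qed
  have imK: "h ` carrier M = K" using hK fixK by (force simp: K_def)
  have K: "direct_summand R M K" by (rule direct_summandI[OF hom imK fixK])
  have "direct_summand R M (B \<inter> K)"
    by (rule assms[OF B K e(1) q hom imK[symmetric] hq qh_eq K_def])
  then obtain k where k: "k \<in> module_hom R M M" "k ` carrier M = B \<inter> K" "\<And>x. x \<in> B \<inter> K \<Longrightarrow> k x = x"
    by (rule direct_summandE) auto
  have BK: "x \<in> K \<longleftrightarrow> e x \<in> B" if x: "x \<in> B" for x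
  proof -
    have xM: "x \<in> carrier M" using x subB(1) by blast
    \<comment> \<open>Here \<open>q x = x\<close>, so membership in \<open>K\<close> says
      \<open>x - e x \<in> B\<close>. Subtracting from \<open>x\<close> exchanges \<open>e x\<close>
      and \<open>x - e x\<close>, so closure of \<open>B\<close> under differences gives both
      directions.\<close>
    have "e x = x \<ominus>\<^bsub>M\<^esub> (x \<ominus>\<^bsub>M\<^esub> e x)"
      using xM by (simp add: eh a_minus_def M.minus_add M.r_neg1 M.r_neg2)
    then show ?thesis using subB(5)[OF x, of "e x"] subB(5)[OF x, of "x \<ominus>\<^bsub>M\<^esub> e x"] xM x q(3)
      by (auto simp: K_def)
  qed
  show "direct_summand R M (A \<inter> B)"
  proof (rule direct_summandI[OF module_hom_comp[OF k(1) e(1)]])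
    \<comment> \<open>For \<open>x\<close> in \<open>A \<inter> B\<close>,
      \<open>e x = x \<in> B\<close> puts \<open>x\<close> into \<open>K\<close> by
      \<open>BK\<close>, so \<open>k\<close> and \<open>e\<close> both fix it.\<close>
    have idem: "e (k x) = x" if "x \<in> A \<inter> B" for x using that e(3) k(3) BK by auto
    then show "x \<in> A \<inter> B \<Longrightarrow> e (k x) = x" for x .
    have "e (k x) \<in> A \<inter> B" if "x \<in> carrier M" for x
    proof -
      \<comment> \<open>By \<open>BK\<close>, \<open>e\<close> sends elements of
        \<open>B \<inter> K\<close> into \<open>B\<close>, while its values always lie in
        \<open>A\<close>.\<close>
      have "k x \<in> B \<inter> K" using k(2) that by blast
      then show ?thesis using BK eA subB(1) by blast
    qed
    then show "(\<lambda>x. e (k x)) ` carrier M = A \<inter> B" using idem subB(1) by force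
  qed
qed

section \<open>The conditions on split monomorphisms and split epimorphisms each imply SIP\<close>

text \<open>The condition is applied to \<open>h\<close> restricted to \<open>B\<close>:
  \<open>h q = h\<close> shows that \<open>B\<close> already maps onto all of \<open>K\<close>, and
  \<open>q h = q\<close> makes \<open>q\<close> a left inverse of \<open>h\<close> on
  \<open>B\<close>.\<close>

lemma SIP_if_split_mono:
  assumes "\<And>A f. \<lbrakk>direct_summand R M A; split_mono R (M\<lparr>carrier := A\<rparr>) M f\<rbrakk>
    \<Longrightarrow> direct_summand R M (A \<inter> f ` A)"
  shows "SIP R M"
proof (rule SIP_criterion)
  fix B e q h K
  assume B: "direct_summand R M B" and K: "direct_summand R M K"
    and q: "q ` carrier M = B" "\<And>x. x \<in> B \<Longrightarrow> q x = x"
    and h: "h \<in> module_hom R M M" and imK: "K = h ` carrier M"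
    and hq: "\<And>x. x \<in> carrier M \<Longrightarrow> h (q x) = h x"
    and qh: "\<And>x. x \<in> carrier M \<Longrightarrow> q (h x) = q x"
  have BM: "B \<subseteq> carrier M" by (rule submoduleD(1)[OF direct_summandD[OF B]])
  have "h ` B = K" unfolding imK q(1)[symmetric] image_image using hq by (intro image_cong) auto
  moreover have "inj_on h B" by (rule inj_on_inverseI[of _ q]) (use BM qh q(2) in auto)
  moreover have "h \<in> module_hom R (M\<lparr>carrier := B\<rparr>) M"
    using h BM by (auto simp: module_hom_def subset_iff)
  ultimately show "direct_summand R M (B \<inter> K)"
    using assms[OF B, of h] K by (simp add: split_mono_def)
qed

text \<open>The condition is applied to \<open>1 - e q\<close> followed by the projection modulo
  \<open>B\<close>; the membership description of \<open>K\<close> says exactly that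
  \<open>K\<close> is the kernel of this composite.\<close>

lemma SIP_if_split_epi:
  assumes "\<And>A f. \<lbrakk>direct_summand R M A; split_epi R M (quot_module M A) f\<rbrakk>
    \<Longrightarrow> direct_summand R M (A \<inter> a_kernel M (quot_module M A) f)"
  shows "SIP R M"
proof (rule SIP_criterion)
  fix B e q K
  assume B: "direct_summand R M B" and K: "direct_summand R M K"
    and e: "e \<in> module_hom R M M"
    and q: "q \<in> module_hom R M M" "q ` carrier M = B" "\<And>x. x \<in> B \<Longrightarrow> q x = x"
    and K_eq: "K = {x \<in> carrier M. x \<ominus>\<^bsub>M\<^esub> e (q x) \<in> B}"
  note subB = direct_summandD[OF B]
  note eh = module_homD[OF e] module_hom_zero_minus[OF e]
  note qh = module_homD[OF q(1)] module_hom_zero_minus[OF q(1)]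
  have qB: "q x \<in> B" if "x \<in> carrier M" for x using q(2) that by blast
  have minus_zero: "\<ominus>\<^bsub>M\<^esub> \<zero>\<^bsub>M\<^esub> = \<zero>\<^bsub>M\<^esub>" using M.add.inv_one by (simp add: a_inv_def)
  define f where "f x = B +>\<^bsub>M\<^esub> (x \<ominus>\<^bsub>M\<^esub> e (q x))" for x
  \<comment> \<open>Writing the zero of the quotient as a coset allows the equation
    \<open>f x = 0\<close> to be decided by the coset criterion.\<close>
  have zero: "\<zero>\<^bsub>quot_module M B\<^esub> = B +>\<^bsub>M\<^esub> \<zero>\<^bsub>M\<^esub>"
    using M.a_coset_add_zero[OF submoduleD(1)[OF subB]] by (simp add: quot_module_def)
  have ker: "a_kernel M (quot_module M B) f = K"
    unfolding a_kernel_def' zero f_def K_eq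
    by (simp add: submodule_coset_eq_iff[OF subB] eh qh a_minus_def minus_zero cong: conj_cong)
  have hom: "f \<in> module_hom R M (quot_module M B)"
    unfolding f_def[abs_def]
    by (rule module_hom_comp[OF module_hom_diff[OF module_hom_id module_hom_comp[OF q(1) e]]
          coset_hom[OF subB]])
  \<comment> \<open>The preimage is \<open>y - q y\<close>: \<open>q\<close> kills it, so
    \<open>f\<close> acts on it as the plain projection, and it differs from \<open>y\<close> by
    \<open>q y \<in> B\<close>.\<close>
  have "B +>\<^bsub>M\<^esub> y \<in> f ` carrier M" if y: "y \<in> carrier M" for y
  proof
    have "q (y \<ominus>\<^bsub>M\<^esub> q y) = \<zero>\<^bsub>M\<^esub>" using y q(3)[OF qB[OF y]] by (simp add: qh a_minus_def M.r_neg)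
    then have "f (y \<ominus>\<^bsub>M\<^esub> q y) = B +>\<^bsub>M\<^esub> (y \<ominus>\<^bsub>M\<^esub> q y)"
      using y by (simp add: f_def eh qh(1) a_minus_def minus_zero)
    moreover have "y \<ominus>\<^bsub>M\<^esub> (y \<ominus>\<^bsub>M\<^esub> q y) = q y"
      using y by (simp add: qh a_minus_def M.minus_add M.r_neg1 M.r_neg2)
    ultimately show "B +>\<^bsub>M\<^esub> y = f (y \<ominus>\<^bsub>M\<^esub> q y)"
      using submodule_coset_eq_iff[OF subB y, of "y \<ominus>\<^bsub>M\<^esub> q y"] y qB[OF y] by (simp add: qh)
    show "y \<ominus>\<^bsub>M\<^esub> q y \<in> carrier M" using y by (simp add: qh)
  qed
  then have "f ` carrier M = carrier (quot_module M B)"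
    using module_homD(1)[OF hom] by (auto simp: quot_module_def A_RCOSETS_def')
  then show "direct_summand R M (B \<inter> K)"
    using assms[OF B, of f] K hom ker by (simp add: split_epi_def)
qed

end

section \<open>The equivalence of SIP with each of the two conditions\<close>

theorem proposition2p4:
  fixes R :: "('r, 'k) ring_scheme" and M :: "('r, 'm, 'l) module_scheme"
  assumes "right_module R M"
  shows "(SIP R M \<longleftrightarrow>
           (\<forall>A f. direct_summand R M A \<longrightarrow> split_mono R (M\<lparr>carrier := A\<rparr>) M f \<longrightarrow>
              direct_summand R M (A \<inter> f ` A)))
       \<and> (SIP R M \<longleftrightarrow>
           (\<forall>A f. direct_summand R M A \<longrightarrow> split_epi R M (quot_module M A) f \<longrightarrow>
              direct_summand R M (A \<inter> a_kernel M (quot_module M A) f)))"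
proof -
  interpret right_module R M by fact
  show ?thesis
  proof (intro conjI iffI)
    show "SIP R M"
      if "\<forall>A f. direct_summand R M A \<longrightarrow> split_mono R (M\<lparr>carrier := A\<rparr>) M f \<longrightarrow>
              direct_summand R M (A \<inter> f ` A)"
      using that by (intro SIP_if_split_mono) auto
    show "SIP R M"
      if "\<forall>A f. direct_summand R M A \<longrightarrow> split_epi R M (quot_module M A) f \<longrightarrow>
              direct_summand R M (A \<inter> a_kernel M (quot_module M A) f)"
      using that by (intro SIP_if_split_epi) auto
  \<comment> \<open>The forward implications remain; the image of a split monomorphism and the
    kernel of a split epimorphism are summands by definition, so SIP applies directly.\<close>
  qed (auto simp: SIP_def split_mono_def split_epi_def)
qed

end
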